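(* Let $\Omega\subset\mathbb{R}^n$ be a bounded domain, $S_1,S_2\subset\Omega$, and $\vec F\in C^{1}(\Omega)\cap C^0(\bar\Omega)$ a vector field. Let $u\in C^0(\bar\Omega\setminus S_1)$, $v\in C^0(\bar\Omega\setminus S_2)$, let $S(u,\vec F)$ (resp. $S(v,\vec F)$) be the set of points of $\Omega\setminus S_1$ (resp. $\Omega\setminus S_2$) where $\nabla u+\vec F=0$ (resp. $\nabla v+\vec F=0$), and let $S_{\vec F}=S_1\cup S_2\cup S(u,\vec F)\cup S(v,\vec F)$. Assume $u,v\in C^2(\Omega\setminus S_{\vec F})$ and $\mathcal{H}_{n-1}(\bar S_{\vec F})=0$, where $\mathcal{H}_{n-1}$ is the $(n-1)$-dimensional Hausdorff measure. Suppose $$\operatorname{div}\Big(\frac{\nabla u+\vec F}{|\nabla u+\vec F|}\Big)\ge\operatorname{div}\Big(\frac{\nabla v+\vec F}{|\nabla v+\vec F|}\Big)\ \text{ in }\Omega\setminus S_{\vec F},\qquad u\le v\ \text{ on }\partial\Omega\setminus S_{\vec F}.$$ Then $\frac{\nabla u+\vec F}{|\nabla u+\vec F|}=\frac{\nabla v+\vec F}{|\nabla v+\vec F|}$ in $\Omega^+\setminus S_{\vec F}$, where $\Omega^+=\{p\in\Omega:u(p)-v(p)>0\}$. *)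

theory Defs
  imports "HOL-Analysis.Analysis"
begin

definition hausdorff_const :: "real \<Rightarrow> real" where
  "hausdorff_const s = pi powr (s / 2) / Gamma (s / 2 + 1)"

text \<open>Contribution of one covering set C to the s-dimensional sum:
  omega_s (diam C / 2)^s, with the conventions that the empty set contributes 0
  and that t^0 = 1 (so that H^0 is the counting measure).\<close>
definition hcontrib :: "real \<Rightarrow> 'a::metric_space set \<Rightarrow> ennreal" where
  "hcontrib s C = (if C = {} then 0
     else if s = 0 then ennreal (hausdorff_const s)
     else ennreal (hausdorff_const s * (diameter C / 2) powr s))"

definition hausdorff_pre :: "real \<Rightarrow> real \<Rightarrow> 'a::metric_space set \<Rightarrow> ennreal" where
  "hausdorff_pre s \<delta> E =
     (INF C \<in> {C :: nat \<Rightarrow> 'a set. E \<subseteq> (\<Union>i. C i) \<and>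
                (\<forall>i. bounded (C i) \<and> diameter (C i) \<le> \<delta>)}.
        (\<Sum>i. hcontrib s (C i)))"

definition hausdorff_measure :: "real \<Rightarrow> 'a::metric_space set \<Rightarrow> ennreal" where
  "hausdorff_measure s E = (SUP \<delta> \<in> {0<..}. hausdorff_pre s \<delta> E)"

definition grad :: "('a::euclidean_space \<Rightarrow> real) \<Rightarrow> 'a \<Rightarrow> 'a" where
  "grad u x = (\<Sum>b\<in>Basis. frechet_derivative u (at x) b *\<^sub>R b)"

definition divergence :: "('a::euclidean_space \<Rightarrow> 'a) \<Rightarrow> 'a \<Rightarrow> real" where
  "divergence G x = (\<Sum>b\<in>Basis. frechet_derivative G (at x) b \<bullet> b)"

definition C1_on :: "'a::euclidean_space set \<Rightarrow> ('a \<Rightarrow> 'b::real_normed_vector) \<Rightarrow> bool" where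
  "C1_on S f \<longleftrightarrow> (\<forall>x\<in>S. f differentiable (at x)) \<and>
      (\<forall>b\<in>Basis. continuous_on S (\<lambda>x. frechet_derivative f (at x) b))"

definition C2_on :: "'a::euclidean_space set \<Rightarrow> ('a \<Rightarrow> real) \<Rightarrow> bool" where
  "C2_on S u \<longleftrightarrow> C1_on S u \<and> C1_on S (grad u)"

definition nfield :: "('a::euclidean_space \<Rightarrow> real) \<Rightarrow> ('a \<Rightarrow> 'a) \<Rightarrow> 'a \<Rightarrow> 'a" where
  "nfield u F x = (1 / norm (grad u x + F x)) *\<^sub>R (grad u x + F x)"

definition singset :: "'a::euclidean_space set \<Rightarrow> 'a set \<Rightarrow> ('a \<Rightarrow> real) \<Rightarrow> ('a \<Rightarrow> 'a) \<Rightarrow> 'a set" where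
  "singset \<Omega> S u F = {x \<in> \<Omega> - S. u differentiable (at x) \<and> grad u x + F x = 0}"

end

theory Submission
  imports Defs
begin

text \<open>
  Write \<open>N\<^sub>u\<close>, \<open>N\<^sub>v\<close> for the two normalized fields and \<open>K\<close> for the closure of the singular set.
  Instead of cutting \<open>\<Omega>\<close> along a regular level set of \<open>u - v\<close> (Sard), test the divergence inequality with
  \<open>\<theta> \<phi>(u - v)\<close>, where \<open>\<phi>\<close> vanishes on \<open>t \<le> \<epsilon>\<close>, is strictly increasing beyond \<open>\<epsilon>\<close> and is bounded by 1, and
  \<open>\<theta>\<close> is a cutoff vanishing on a finite ball cover of \<open>K\<close>. The field \<open>\<theta> \<phi>(u - v) (N\<^sub>u - N\<^sub>v)\<close> has compact
  support off \<open>K\<close> and the boundary, so its divergence integrates to zero. This bounds the integral of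
  \<open>\<theta> \<phi>'(u - v) (\<nabla>u - \<nabla>v) \<bullet> (N\<^sub>u - N\<^sub>v)\<close> by twice that of \<open>|\<nabla>\<theta>|\<close>, which is of the order of the sum of
  \<open>r\<^sub>i\<close> to the power \<open>n - 1\<close> over the cover, hence arbitrarily small. Since
  \<open>(\<nabla>u - \<nabla>v) \<bullet> (N\<^sub>u - N\<^sub>v) \<ge> 0\<close>, with equality only if \<open>N\<^sub>u = N\<^sub>v\<close>, the fields agree off \<open>K\<close>; as \<open>K\<close> has
  empty interior, continuity covers the remaining points.
\<close>

subsection \<open>Continuously differentiable maps and the divergence theorem for compact support\<close>

text \<open>The derivative is carried as an explicit map, so that the product and chain rules
  compute it and its sum over the basis can be read off as a divergence. Continuity is asked for
  each fixed direction; in finite dimension this amounts to continuity in operator norm.\<close>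

definition has_C1_deriv ::
  "'a::euclidean_space set \<Rightarrow> ('a \<Rightarrow> 'b::real_normed_vector) \<Rightarrow> ('a \<Rightarrow> 'a \<Rightarrow> 'b) \<Rightarrow> bool" where
  "has_C1_deriv D f f' \<longleftrightarrow>
     (\<forall>x\<in>D. (f has_derivative f' x) (at x)) \<and> (\<forall>h. continuous_on D (\<lambda>x. f' x h))"

lemma has_C1_derivI:
  assumes "\<And>x. x \<in> D \<Longrightarrow> (f has_derivative f' x) (at x)" "\<And>h. continuous_on D (\<lambda>x. f' x h)"
  shows "has_C1_deriv D f f'"
  using assms by (simp add: has_C1_deriv_def)

lemma has_C1_deriv_derivative:
  "has_C1_deriv D f f' \<Longrightarrow> x \<in> D \<Longrightarrow> (f has_derivative f' x) (at x)"
  by (simp add: has_C1_deriv_def)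

lemma has_C1_deriv_continuous_on_deriv:
  "has_C1_deriv D f f' \<Longrightarrow> continuous_on D (\<lambda>x. f' x h)"
  by (simp add: has_C1_deriv_def)

lemma has_C1_deriv_continuous_on:
  assumes "has_C1_deriv D f f'" shows "continuous_on D f"
  by (meson assms continuous_at_imp_continuous_on has_C1_deriv_derivative has_derivative_continuous)

lemma has_C1_deriv_subset:
  "has_C1_deriv D f f' \<Longrightarrow> E \<subseteq> D \<Longrightarrow> has_C1_deriv E f f'"
  unfolding has_C1_deriv_def by (meson continuous_on_subset subsetD)

lemmas has_C1_deriv_continuous_intros =
  has_C1_deriv_continuous_on has_C1_deriv_continuous_on_deriv

section \<open>Sum, product and chain rules\<close>

lemma has_C1_deriv_add:
  assumes "has_C1_deriv D f f'" "has_C1_deriv D g g'"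
  shows "has_C1_deriv D (\<lambda>x. f x + g x) (\<lambda>x h. f' x h + g' x h)"
  using assms unfolding has_C1_deriv_def
  by (auto intro!: has_derivative_add continuous_intros)

lemma has_C1_deriv_diff:
  assumes "has_C1_deriv D f f'" "has_C1_deriv D g g'"
  shows "has_C1_deriv D (\<lambda>x. f x - g x) (\<lambda>x h. f' x h - g' x h)"
  using assms unfolding has_C1_deriv_def
  by (auto intro!: has_derivative_diff continuous_intros)

lemma has_C1_deriv_scaleR:
  assumes "has_C1_deriv D f f'" "has_C1_deriv D g g'"
  shows "has_C1_deriv D (\<lambda>x. f x *\<^sub>R g x) (\<lambda>x h. f x *\<^sub>R g' x h + f' x h *\<^sub>R g x)"
  using assms
  by (auto intro!: has_C1_derivI has_derivative_scaleR continuous_intros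
      intro: has_C1_deriv_continuous_intros has_C1_deriv_derivative)

lemma has_C1_deriv_inner:
  fixes f g :: "'a::euclidean_space \<Rightarrow> 'b::real_inner"
  assumes "has_C1_deriv D f f'" "has_C1_deriv D g g'"
  shows "has_C1_deriv D (\<lambda>x. f x \<bullet> g x) (\<lambda>x h. f x \<bullet> g' x h + f' x h \<bullet> g x)"
  using assms
  by (auto intro!: has_C1_derivI has_derivative_inner continuous_intros
      intro: has_C1_deriv_continuous_intros has_C1_deriv_derivative)

lemma has_C1_deriv_mult:
  fixes f g :: "'a::euclidean_space \<Rightarrow> real"
  assumes "has_C1_deriv D f f'" "has_C1_deriv D g g'"
  shows "has_C1_deriv D (\<lambda>x. f x * g x) (\<lambda>x h. f x * g' x h + f' x h * g x)"
  using has_C1_deriv_scaleR[OF assms] by simp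

text \<open>The set \<open>T\<close> admits outer functions that are smooth on part of the line
  only, such as \<open>1 / sqrt t\<close> on the positive reals.\<close>

lemma has_C1_deriv_compose_real:
  fixes f :: "'a::euclidean_space \<Rightarrow> real"
  assumes f: "has_C1_deriv D f f'"
    and k: "\<And>t. t \<in> T \<Longrightarrow> (k has_real_derivative k' t) (at t)" "continuous_on T k'"
    and T: "f ` D \<subseteq> T"
  shows "has_C1_deriv D (\<lambda>x. k (f x)) (\<lambda>x h. k' (f x) * f' x h)"
proof (rule has_C1_derivI)
  fix x assume x: "x \<in> D"
  have "(k has_real_derivative k' (f x)) (at (f x))" using k T x by auto
  then show "((\<lambda>x. k (f x)) has_derivative (\<lambda>h. k' (f x) * f' x h)) (at x)"
    using has_derivative_compose[OF has_C1_deriv_derivative[OF f x], of k "(*) (k' (f x))"]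
    by (simp add: has_field_derivative_def)
next
  fix h
  show "continuous_on D (\<lambda>x. k' (f x) * f' x h)"
    by (intro continuous_intros continuous_on_compose2[OF k(2) _ T]
        has_C1_deriv_continuous_intros[OF f])
qed

text \<open>\<open>C1_on\<close> controls the basis directions; by linearity the derivative along
  \<open>h\<close> is their combination with the coordinates of \<open>h\<close> as
  coefficients.\<close>

lemma C1_on_has_C1_deriv:
  assumes "C1_on D f"
  shows "has_C1_deriv D f (\<lambda>x. frechet_derivative f (at x))"
proof (rule has_C1_derivI)
  fix x assume "x \<in> D"
  with assms show "(f has_derivative frechet_derivative f (at x)) (at x)"
    by (simp add: C1_on_def frechet_derivative_works)
next
  fix h
  have "frechet_derivative f (at x) h = (\<Sum>b\<in>Basis. (h \<bullet> b) *\<^sub>R frechet_derivative f (at x) b)"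
    if "x \<in> D" for x
  proof -
    have "linear (frechet_derivative f (at x))"
      using assms that by (simp add: C1_on_def linear_frechet_derivative)
    then have "frechet_derivative f (at x) (\<Sum>b\<in>Basis. (h \<bullet> b) *\<^sub>R b) =
        (\<Sum>b\<in>Basis. (h \<bullet> b) *\<^sub>R frechet_derivative f (at x) b)"
      by (simp add: linear_sum linear_scale)
    then show ?thesis by (simp add: euclidean_representation)
  qed
  moreover have "continuous_on D (\<lambda>x. \<Sum>b\<in>Basis. (h \<bullet> b) *\<^sub>R frechet_derivative f (at x) b)"
    using assms unfolding C1_on_def by (intro continuous_intros) auto
  ultimately show "continuous_on D (\<lambda>x. frechet_derivative f (at x) h)"
    by (simp cong: continuous_on_cong_simp)
qed

lemma frechet_derivative_eq_grad:
  assumes "u differentiable (at x)"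
  shows "frechet_derivative u (at x) h = grad u x \<bullet> h"
proof -
  have lin: "linear (frechet_derivative u (at x))"
    using assms by (simp add: linear_frechet_derivative)
  have "frechet_derivative u (at x) (\<Sum>b\<in>Basis. (h \<bullet> b) *\<^sub>R b) =
      (\<Sum>b\<in>Basis. (h \<bullet> b) * frechet_derivative u (at x) b)"
    by (simp add: lin linear_sum linear_scale)
  then show ?thesis
    by (simp add: euclidean_representation grad_def inner_sum_right inner_commute[of _ h] mult.commute)
qed

lemma divergence_eq:
  "(G has_derivative G') (at x) \<Longrightarrow> divergence G x = (\<Sum>b\<in>Basis. G' b \<bullet> b)"
  unfolding divergence_def using frechet_derivative_at by fastforce

section \<open>Integrals of derivatives of compactly supported maps\<close>

lemma has_bochner_integral_lborel_translate:
  fixes f :: "'a::euclidean_space \<Rightarrow> real"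
  assumes "integrable lborel f"
  shows "has_bochner_integral lborel (\<lambda>x. f (x + a)) (integral\<^sup>L lborel f)"
proof -
  have "has_bochner_integral (distr lborel borel ((+) a)) f (integral\<^sup>L lborel f)"
    using assms by (simp add: lborel_distr_plus has_bochner_integral_integrable)
  then have i: "integrable (distr lborel borel ((+) a)) f"
      "integral\<^sup>L (distr lborel borel ((+) a)) f = integral\<^sup>L lborel f"
    by (auto simp: has_bochner_integral_iff)
  have m: "f \<in> borel_measurable borel" using assms by auto
  show ?thesis
    using i m by (auto simp: has_bochner_integral_iff integrable_distr_eq integral_distr add.commute)
qed

text \<open>By translation invariance the difference quotients have integral zero.\<close>
lemma integral_directional_derivative_zero:
  fixes f :: "'a::euclidean_space \<Rightarrow> real"
  assumes f: "\<And>x. (f has_derivative f' x) (at x)"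
    and supp: "\<And>x. x \<notin> cball 0 R \<Longrightarrow> f x = 0"
    and bd: "\<And>x. \<bar>f' x b\<bar> \<le> M"
    and b: "norm b \<le> 1"
  shows "has_bochner_integral lborel (\<lambda>x. f' x b) 0"
proof -
  have cf: "continuous_on UNIV f"
    using f by (meson continuous_at_imp_continuous_on has_derivative_continuous)
  then have mf: "f \<in> borel_measurable borel" by (rule borel_measurable_continuous_onI)
  have fin: "emeasure lborel (cball (0::'a) S) < \<infinity>" for S
    by (rule emeasure_lborel_cball_finite)
  obtain B where B: "\<And>x. x \<in> cball 0 R \<Longrightarrow> \<bar>f x\<bar> \<le> B"
    using compact_imp_bounded[OF compact_continuous_image[OF continuous_on_subset[OF cf] compact_cball]]
    unfolding bounded_real by (metis imageI subset_UNIV)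
  have intf: "integrable lborel f"
  proof (rule Bochner_Integration.integrable_bound)
    show "integrable lborel (\<lambda>x::'a. B * indicator (cball 0 R) x :: real)"
      using fin by (intro integrable_mult_right integrable_real_indicator) auto
    show "AE x in lborel. norm (f x) \<le> norm (B * indicator (cball 0 R) x)"
      using B supp by (fastforce simp: indicator_def intro!: AE_I2)
  qed (use mf in simp)
  \<comment> \<open>Step sizes tending to 0. Being at most 1, they keep every difference quotient
    supported in \<open>cball 0 (R + 1)\<close>.\<close>
  define t where "t n = 1 / (real n + 1)" for n
  have t: "0 < t n" "t n \<le> 1" for n by (auto simp: t_def)
  have t0: "t \<longlonglongrightarrow> 0" unfolding t_def by real_asymp
  define s where "s n x = (f (x + t n *\<^sub>R b) - f x) / t n" for n x
  have s_int: "has_bochner_integral lborel (s n) 0" for n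
  proof -
    have "has_bochner_integral lborel (\<lambda>x. f (x + t n *\<^sub>R b) - f x)
        (integral\<^sup>L lborel f - integral\<^sup>L lborel f)"
      by (intro has_bochner_integral_diff has_bochner_integral_lborel_translate intf
          has_bochner_integral_integrable)
    from has_bochner_integral_divide_zero[OF this, of "t n"] show ?thesis
      by (simp add: s_def[abs_def])
  qed
  have deriv: "((\<lambda>r. f (x + r *\<^sub>R b)) has_real_derivative f' (x + r *\<^sub>R b) b) (at r)" for x r
  proof -
    have "((\<lambda>r. f (x + r *\<^sub>R b)) has_derivative (\<lambda>h. f' (x + r *\<^sub>R b) (h *\<^sub>R b))) (at r)"
      by (rule has_derivative_compose[OF _ f]) (auto intro!: derivative_eq_intros)
    moreover have "f' (x + r *\<^sub>R b) (h *\<^sub>R b) = f' (x + r *\<^sub>R b) b * h" for h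
      using f[of "x + r *\<^sub>R b"] by (simp add: has_derivative_linear linear_scale)
    ultimately show ?thesis by (simp add: has_field_derivative_def)
  qed
  have lim: "(\<lambda>n. s n x) \<longlonglongrightarrow> f' x b" for x
  proof -
    have "((\<lambda>h. (f (x + h *\<^sub>R b) - f x) / h) \<longlongrightarrow> f' x b) (at 0)"
      using deriv[of x 0] by (simp add: DERIV_def)
    moreover have "filterlim t (at 0) sequentially"
      using t0 t by (auto simp: filterlim_at intro!: always_eventually less_imp_neq[symmetric])
    ultimately show ?thesis unfolding s_def by (rule filterlim_compose)
  qed
  \<comment> \<open>Integrable dominating function: inside the larger ball the mean value theorem
    turns the quotient into a value of the derivative; outside it \<open>f\<close> vanishes at both
    points of the quotient.\<close>
  have bound: "norm (s n x) \<le> M * indicator (cball 0 (R + 1)) x" for n x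
  proof (cases "x \<in> cball 0 (R + 1)")
    case True
    have "\<exists>r. 0 < r \<and> r < t n \<and> f (x + t n *\<^sub>R b) - f (x + 0 *\<^sub>R b) = (t n - 0) * f' (x + r *\<^sub>R b) b"
      by (rule MVT2[OF t(1)]) (rule deriv)
    then obtain r where "f (x + t n *\<^sub>R b) - f x = t n * f' (x + r *\<^sub>R b) b" by auto
    then have "s n x = f' (x + r *\<^sub>R b) b" using t(1)[of n] by (simp add: s_def)
    then show ?thesis using bd True by simp
  next
    case False
    have "norm (t n *\<^sub>R b) \<le> 1" using t[of n] b by (simp add: mult_le_one)
    then have "norm x \<le> norm (x + t n *\<^sub>R b) + 1"
      using norm_triangle_ineq4[of "x + t n *\<^sub>R b" "t n *\<^sub>R b"] by simp
    then have "x + t n *\<^sub>R b \<notin> cball 0 R" "x \<notin> cball 0 R" using False by auto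
    then show ?thesis using supp False by (simp add: s_def)
  qed
  have sm: "s n \<in> borel_measurable lborel" for n
    using s_int has_bochner_integral_iff borel_measurable_integrable by blast
  \<comment> \<open>The derivative is not assumed continuous; it is measurable as a pointwise limit
    of measurable quotients.\<close>
  have fm: "(\<lambda>x. f' x b) \<in> borel_measurable lborel"
    by (rule borel_measurable_LIMSEQ_real[OF lim sm])
  have dom: "integrable lborel (\<lambda>x::'a. M * indicator (cball 0 (R + 1)) x :: real)"
    using fin by (intro integrable_mult_right integrable_real_indicator) auto
  note dc = fm sm dom AE_I2[OF lim] AE_I2[OF bound]
  have "(\<lambda>n. integral\<^sup>L lborel (s n)) \<longlonglongrightarrow> integral\<^sup>L lborel (\<lambda>x. f' x b)"
    by (rule integral_dominated_convergence[OF dc])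
  then have "integral\<^sup>L lborel (\<lambda>x. f' x b) = 0"
    using s_int by (simp add: has_bochner_integral_iff LIMSEQ_const_iff)
  then show ?thesis
    using integrable_dominated_convergence[OF dc] by (simp add: has_bochner_integral_iff)
qed

text \<open>Extended by zero outside \<open>D\<close>, the field is differentiable everywhere,
  because it vanishes on the open set \<open>- A\<close>. Each diagonal term of its derivative is
  then a directional derivative of a compactly supported function and integrates to zero.\<close>

lemma integral_divergence_zero:
  fixes W :: "'a::euclidean_space \<Rightarrow> 'a"
  assumes W: "has_C1_deriv D W W'" and D: "open D" and A: "compact A" "A \<subseteq> D"
    and supp: "\<And>x. x \<in> D - A \<Longrightarrow> W x = 0"
  shows "has_bochner_integral lborel
           (\<lambda>x. if x \<in> D then \<Sum>b\<in>Basis. W' x b \<bullet> b else 0) 0"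
proof -
  define V where "V x = (if x \<in> D then W x else 0)" for x
  define V' where "V' x = (if x \<in> D then W' x else (\<lambda>h. 0))" for x
  have V0: "V x = 0" if "x \<notin> A" for x using that supp by (auto simp: V_def)
  have z: "(V has_derivative (\<lambda>h. 0)) (at x)" if "x \<notin> A" for x
    by (rule has_derivative_transform_within_open[OF has_derivative_const, of "- A" _ 0])
      (use that A(1) V0 in \<open>auto simp: compact_imp_closed open_Compl\<close>)
  have V: "(V has_derivative V' x) (at x)" for x
  proof (cases "x \<in> D")
    case True
    then show ?thesis
      using has_derivative_transform_within_open[OF has_C1_deriv_derivative[OF W True] D True, of V]
      by (simp add: V_def V'_def)
  next
    case False
    then show ?thesis using z[of x] A(2) by (auto simp: V'_def)
  qed
  \<comment> \<open>Hence a bound for the derivative on the compact set \<open>A\<close> is a bound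
    on the whole space.\<close>
  have V'0: "V' x = (\<lambda>h. 0)" if "x \<notin> A" for x
    using has_derivative_unique[OF V z[OF that]] .
  obtain R where R: "A \<subseteq> cball 0 R"
    using compact_imp_bounded[OF A(1)] by (auto simp: bounded_iff subset_iff)
  have "has_bochner_integral lborel (\<lambda>x. V' x b \<bullet> b) 0" if b: "b \<in> Basis" for b
  proof -
    have "continuous_on A (\<lambda>x. W' x b \<bullet> b)"
      by (intro continuous_intros continuous_on_subset[OF _ A(2)]
          has_C1_deriv_continuous_on_deriv[OF W])
    then have "bounded ((\<lambda>x. W' x b \<bullet> b) ` A)"
      using A(1) by (intro compact_imp_bounded compact_continuous_image)
    then obtain M where M: "\<And>x. x \<in> A \<Longrightarrow> \<bar>W' x b \<bullet> b\<bar> \<le> M"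
      unfolding bounded_real by auto
    show ?thesis
    proof (rule integral_directional_derivative_zero[of "\<lambda>x. V x \<bullet> b" "\<lambda>x h. V' x h \<bullet> b"])
      show "((\<lambda>x. V x \<bullet> b) has_derivative (\<lambda>h. V' x h \<bullet> b)) (at x)" for x
        by (rule has_derivative_inner_left[OF V])
      show "V x \<bullet> b = 0" if "x \<notin> cball 0 R" for x
        using V0[of x] that R by (metis inner_zero_left subsetD)
      show "\<bar>V' x b \<bullet> b\<bar> \<le> max M 0" for x
        using M[of x] V'0[of x] A(2) by (cases "x \<in> A") (auto simp: V'_def)
    qed (use b in simp)
  qed
  then have "has_bochner_integral lborel (\<lambda>x. \<Sum>b\<in>Basis. V' x b \<bullet> b) (\<Sum>b\<in>(Basis::'a set). 0)"
    by (intro has_bochner_integral_sum) auto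
  moreover have "(\<Sum>b\<in>Basis. V' x b \<bullet> b) = (if x \<in> D then \<Sum>b\<in>Basis. W' x b \<bullet> b else 0)" for x
    by (simp add: V'_def)
  ultimately show ?thesis by simp
qed

subsection \<open>Cutoff functions\<close>

text \<open>Squaring makes the positive part continuously differentiable; all test functions below
  are built from it.\<close>

definition sqpos :: "real \<Rightarrow> real" where
  "sqpos t = (max 0 t)\<^sup>2"

lemma sqpos_nonneg [simp]: "0 \<le> sqpos t"
  by (simp add: sqpos_def)

lemma sqpos_eq_0 [simp]: "t \<le> 0 \<Longrightarrow> sqpos t = 0"
  by (simp add: sqpos_def)

lemma sqpos_has_derivative: "(sqpos has_real_derivative 2 * max 0 t) (at t)"
proof -
  consider "t < 0" | "t = 0" | "t > 0" by linarith
  then show ?thesis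
  proof cases
    case 1
    have "((\<lambda>_. 0) has_real_derivative 2 * max 0 t) (at t)" using 1 by simp
    then show ?thesis
      by (rule has_field_derivative_transform_within[of _ _ _ _ "-t"])
        (use 1 in \<open>auto simp: sqpos_def dist_real_def\<close>)
  next
    case 2
    \<comment> \<open>This is the difference quotient at 0; it is at most
      \<open>\<bar>h\<bar>\<close> in absolute value.\<close>
    have "((\<lambda>h. max 0 h * (max 0 h / h)) \<longlongrightarrow> 0) (at (0::real))"
    proof (rule Lim_null_comparison)
      show "\<forall>\<^sub>F h in at 0. norm (max 0 h * (max 0 h / h)) \<le> \<bar>h\<bar>"
        by (auto intro!: always_eventually simp: max_def)
      show "((\<lambda>h. \<bar>h\<bar>) \<longlongrightarrow> 0) (at (0::real))" by (auto intro!: tendsto_eq_intros)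
    qed
    then show ?thesis using 2 by (simp add: DERIV_def sqpos_def power2_eq_square)
  next
    case 3
    have "((\<lambda>t. t\<^sup>2) has_real_derivative 2 * max 0 t) (at t)"
      using 3 by (auto intro!: derivative_eq_intros)
    then show ?thesis
      by (rule has_field_derivative_transform_within[of _ _ _ _ t])
        (use 3 in \<open>auto simp: sqpos_def dist_real_def\<close>)
  qed
qed

text \<open>This is the function \<phi> before the shift by \<epsilon>. The quotient keeps it below
  1 even where \<open>u - v\<close> is unbounded near the singular set.\<close>

definition bump :: "real \<Rightarrow> real" where
  "bump t = sqpos t / (1 + sqpos t)"

definition bump' :: "real \<Rightarrow> real" where
  "bump' t = 2 * max 0 t / (1 + sqpos t)\<^sup>2"

lemma one_plus_sqpos [simp]: "1 + sqpos t \<noteq> 0" "0 < 1 + sqpos t"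
  using sqpos_nonneg[of t] by linarith+

lemma continuous_on_sqpos [continuous_intros]:
  "continuous_on S f \<Longrightarrow> continuous_on S (\<lambda>x. sqpos (f x))"
  unfolding sqpos_def by (intro continuous_intros)

lemma bump_has_derivative: "(bump has_real_derivative bump' t) (at t)"
  unfolding bump_def[abs_def] bump'_def
  by (rule derivative_eq_intros sqpos_has_derivative refl | simp add: power2_eq_square algebra_simps)+

lemma continuous_on_bump': "continuous_on S bump'"
  unfolding bump'_def[abs_def] by (intro continuous_intros) auto

lemma bump_bounds: "0 \<le> bump t" "bump t \<le> 1"
  by (auto simp: bump_def intro!: divide_nonneg_pos)

lemma bump_nonpos: "t \<le> 0 \<Longrightarrow> bump t = 0"
  by (simp add: bump_def)

lemma bump'_nonneg: "0 \<le> bump' t"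
  by (simp add: bump'_def)

lemma bump'_pos: "0 < t \<Longrightarrow> 0 < bump' t"
  by (simp add: bump'_def)

text \<open>Rises from 0 at \<open>t = 1\<close> to 1 at \<open>t = 4\<close>. The argument will be
  a squared distance divided by \<open>r\<^sup>2\<close>, so these values correspond to the radii
  \<open>r\<close> and \<open>2 * r\<close>.\<close>

definition cutoff :: "real \<Rightarrow> real" where
  "cutoff t = sqpos (1 - sqpos ((4 - t) / 3))"

definition cutoff' :: "real \<Rightarrow> real" where
  "cutoff' t = 4 / 3 * max 0 (1 - sqpos ((4 - t) / 3)) * max 0 ((4 - t) / 3)"

lemma cutoff_has_derivative: "(cutoff has_real_derivative cutoff' t) (at t)"
proof -
  have "((\<lambda>t. sqpos ((4 - t) / 3)) has_real_derivative 2 * max 0 ((4 - t) / 3) * (- 1 / 3)) (at t)"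
    by (rule DERIV_chain2[OF sqpos_has_derivative]) (auto intro!: derivative_eq_intros)
  then have "((\<lambda>t. 1 - sqpos ((4 - t) / 3)) has_real_derivative 2 / 3 * max 0 ((4 - t) / 3)) (at t)"
    by (auto intro!: derivative_eq_intros)
  from DERIV_chain2[OF sqpos_has_derivative this] show ?thesis
    by (simp add: cutoff_def[abs_def] cutoff'_def algebra_simps)
qed

lemma continuous_on_cutoff': "continuous_on S cutoff'"
  unfolding cutoff'_def[abs_def] by (intro continuous_intros) auto

lemma cutoff_le_1: "t \<le> 1 \<Longrightarrow> cutoff t = 0"
  unfolding cutoff_def by (intro sqpos_eq_0) (simp add: sqpos_def)

lemma cutoff_ge_4: "4 \<le> t \<Longrightarrow> cutoff t = 1"
  by (simp add: cutoff_def sqpos_def)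

lemma cutoff'_ge_4: "4 \<le> t \<Longrightarrow> cutoff' t = 0"
  by (simp add: cutoff'_def)

lemma cutoff_bounds: "0 \<le> cutoff t" "cutoff t \<le> 1"
  by (auto simp: cutoff_def) (simp add: sqpos_def power_le_one)

text \<open>If \<open>(4 - t) / 3\<close> exceeds 1, the first maximum in \<open>cutoff'\<close>
  vanishes; otherwise both maxima lie between 0 and 1.\<close>

lemma abs_cutoff'_le: "\<bar>cutoff' t\<bar> \<le> 4 / 3"
proof -
  let ?s = "(4 - t) / 3"
  have "max 0 (1 - sqpos ?s) * max 0 ?s \<le> 1 * 1"
  proof (cases "?s \<le> 1")
    case True
    then show ?thesis by (intro mult_mono) auto
  next
    case False
    then have "1 \<le> sqpos ?s" by (simp add: sqpos_def)
    then show ?thesis by simp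
  qed
  then show ?thesis by (simp add: cutoff'_def abs_mult mult.commute)
qed

text \<open>Composes \<open>cutoff\<close> with the squared distance to \<open>c\<close>, which
  unlike the distance is differentiable at the centre.\<close>

lemma ball_cutoff:
  fixes c :: "'a::euclidean_space"
  assumes r: "0 < r"
  obtains \<theta> \<theta>' where "has_C1_deriv UNIV \<theta> \<theta>'" "\<And>x. 0 \<le> \<theta> x \<and> \<theta> x \<le> 1"
    "\<And>x. x \<in> ball c r \<Longrightarrow> \<theta> x = 0" "\<And>x. x \<notin> cball c (2 * r) \<Longrightarrow> \<theta> x = 1"
    "\<And>x h. \<bar>\<theta>' x h\<bar> \<le> 6 / r * indicator (cball c (2 * r)) x * norm h"
proof
  let ?q = "\<lambda>x. (1 / r\<^sup>2) *\<^sub>R ((x - c) \<bullet> (x - c))"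
  let ?q' = "\<lambda>x h. (1 / r\<^sup>2) *\<^sub>R ((x - c) \<bullet> h + h \<bullet> (x - c))"
  have "has_C1_deriv UNIV ?q ?q'"
    by (intro has_C1_derivI has_derivative_scaleR_right has_derivative_inner continuous_intros)
       (auto intro!: derivative_eq_intros)
  then show "has_C1_deriv UNIV (\<lambda>x. cutoff (?q x)) (\<lambda>x h. cutoff' (?q x) * ?q' x h)"
    by (rule has_C1_deriv_compose_real[OF _ cutoff_has_derivative continuous_on_cutoff'[of UNIV]]) auto
  have q: "?q x = (dist c x / r)\<^sup>2" for x
    by (simp add: dist_norm power_divide power2_norm_eq_inner norm_minus_commute[of c])
  show "0 \<le> cutoff (?q x) \<and> cutoff (?q x) \<le> 1" for x by (simp add: cutoff_bounds)
  show "cutoff (?q x) = 0" if "x \<in> ball c r" for x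
    unfolding q using that r by (intro cutoff_le_1) (simp add: power_le_one)
  have far: "4 \<le> ?q x" if "x \<notin> cball c (2 * r)" for x
  proof -
    have "2 \<le> dist c x / r" using that r by (simp add: field_simps)
    then have "2\<^sup>2 \<le> (dist c x / r)\<^sup>2" by (rule power_mono) simp
    then show ?thesis unfolding q by simp
  qed
  then show "cutoff (?q x) = 1" if "x \<notin> cball c (2 * r)" for x
    using that by (intro cutoff_ge_4)
  show "\<bar>cutoff' (?q x) * ?q' x h\<bar> \<le> 6 / r * indicator (cball c (2 * r)) x * norm h" for x h
  proof (cases "x \<in> cball c (2 * r)")
    case False
    then show ?thesis using cutoff'_ge_4[OF far] by simp
  next
    case True
    have "\<bar>(x - c) \<bullet> h\<bar> \<le> norm (x - c) * norm h" by (rule Cauchy_Schwarz_ineq2)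
    also have "\<dots> \<le> 2 * r * norm h"
      using True by (intro mult_right_mono) (auto simp: dist_norm norm_minus_commute)
    finally have "\<bar>?q' x h\<bar> \<le> 4 * norm h / r"
      using r by (simp add: inner_commute abs_mult field_simps power2_eq_square)
    then have "\<bar>cutoff' (?q x) * ?q' x h\<bar> \<le> 4 / 3 * (4 * norm h / r)"
      unfolding abs_mult by (intro mult_mono abs_cutoff'_le) auto
    \<comment> \<open>The product of the two bounds has the constant 16/3, rounded up to 6.\<close>
    also have "\<dots> \<le> 6 / r * norm h" using r by (simp add: field_simps)
    finally show ?thesis using True by simp
  qed
qed

text \<open>Take the product of the single cutoffs. All factors lie between 0 and 1, so the product
  rule simply adds up the bounds for their derivatives.\<close>

lemma finite_balls_cutoff:
  fixes c :: "'i \<Rightarrow> 'a::euclidean_space"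
  assumes "finite I" "\<And>i. i \<in> I \<Longrightarrow> 0 < r i"
  shows "\<exists>\<theta> \<theta>'. has_C1_deriv UNIV \<theta> \<theta>' \<and> (\<forall>x. 0 \<le> \<theta> x \<and> \<theta> x \<le> 1) \<and>
    (\<forall>x \<in> (\<Union>i\<in>I. ball (c i) (r i)). \<theta> x = 0) \<and>
    (\<forall>x. x \<notin> (\<Union>i\<in>I. cball (c i) (2 * r i)) \<longrightarrow> \<theta> x = 1) \<and>
    (\<forall>x h. \<bar>\<theta>' x h\<bar> \<le> (\<Sum>i\<in>I. 6 / r i * indicator (cball (c i) (2 * r i)) x) * norm h)"
  using assms
proof (induction I rule: finite_induct)
  case empty
  have "has_C1_deriv UNIV (\<lambda>x::'a. 1::real) (\<lambda>x h. 0)"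
    by (auto intro!: has_C1_derivI)
  then show ?case by (intro exI[of _ "\<lambda>x. 1"] exI[of _ "\<lambda>x h. 0"]) simp
next
  case (insert j I)
  have "\<exists>\<theta> \<theta>'. has_C1_deriv UNIV \<theta> \<theta>' \<and> (\<forall>x. 0 \<le> \<theta> x \<and> \<theta> x \<le> 1) \<and>
    (\<forall>x \<in> (\<Union>i\<in>I. ball (c i) (r i)). \<theta> x = 0) \<and>
    (\<forall>x. x \<notin> (\<Union>i\<in>I. cball (c i) (2 * r i)) \<longrightarrow> \<theta> x = 1) \<and>
    (\<forall>x h. \<bar>\<theta>' x h\<bar> \<le> (\<Sum>i\<in>I. 6 / r i * indicator (cball (c i) (2 * r i)) x) * norm h)"
    by (rule insert.IH) (simp add: insert.prems)
  then obtain \<theta> \<theta>' where IH: "has_C1_deriv UNIV \<theta> \<theta>'" "\<And>x. 0 \<le> \<theta> x \<and> \<theta> x \<le> 1"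
    "\<And>x. x \<in> (\<Union>i\<in>I. ball (c i) (r i)) \<Longrightarrow> \<theta> x = 0"
    "\<And>x. x \<notin> (\<Union>i\<in>I. cball (c i) (2 * r i)) \<Longrightarrow> \<theta> x = 1"
    "\<And>x h. \<bar>\<theta>' x h\<bar> \<le> (\<Sum>i\<in>I. 6 / r i * indicator (cball (c i) (2 * r i)) x) * norm h"
    by (elim exE conjE) (rule that, assumption, blast+)
  obtain \<eta> \<eta>' where j: "has_C1_deriv UNIV \<eta> \<eta>'" "\<And>x. 0 \<le> \<eta> x \<and> \<eta> x \<le> 1"
    "\<And>x. x \<in> ball (c j) (r j) \<Longrightarrow> \<eta> x = 0" "\<And>x. x \<notin> cball (c j) (2 * r j) \<Longrightarrow> \<eta> x = 1"
    "\<And>x h. \<bar>\<eta>' x h\<bar> \<le> 6 / r j * indicator (cball (c j) (2 * r j)) x * norm h"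
    using insert.prems by (rule ball_cutoff[of "r j" "c j"]) auto
  have C1: "has_C1_deriv UNIV (\<lambda>x. \<eta> x * \<theta> x) (\<lambda>x h. \<eta> x * \<theta>' x h + \<eta>' x h * \<theta> x)"
    by (rule has_C1_deriv_mult[OF j(1) IH(1)])
  have "\<bar>\<eta> x * \<theta>' x h + \<eta>' x h * \<theta> x\<bar> \<le>
     (\<Sum>i\<in>insert j I. 6 / r i * indicator (cball (c i) (2 * r i)) x) * norm h" for x h
  proof -
    have "\<bar>\<eta> x * \<theta>' x h + \<eta>' x h * \<theta> x\<bar> \<le> \<bar>\<eta> x\<bar> * \<bar>\<theta>' x h\<bar> + \<bar>\<eta>' x h\<bar> * \<bar>\<theta> x\<bar>"
      by (metis abs_mult abs_triangle_ineq)
    also have "\<dots> \<le> 1 * \<bar>\<theta>' x h\<bar> + \<bar>\<eta>' x h\<bar> * 1"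
      using IH(2)[of x] j(2)[of x] by (intro add_mono mult_right_mono mult_left_mono) auto
    also have "\<dots> \<le> (\<Sum>i\<in>insert j I. 6 / r i * indicator (cball (c i) (2 * r i)) x) * norm h"
      using IH(5)[of x h] j(5)[of x h] insert.hyps by (simp add: distrib_right)
    finally show ?thesis .
  qed
  moreover have "0 \<le> \<eta> x * \<theta> x \<and> \<eta> x * \<theta> x \<le> 1" for x
    using IH(2)[of x] j(2)[of x] by (simp add: mult_le_one)
  moreover have "\<eta> x * \<theta> x = 0" if "x \<in> (\<Union>i\<in>insert j I. ball (c i) (r i))" for x
    using that IH(3)[of x] j(3)[of x] by auto
  moreover have "\<eta> x * \<theta> x = 1" if "x \<notin> (\<Union>i\<in>insert j I. cball (c i) (2 * r i))" for x
    using that IH(4)[of x] j(4)[of x] by auto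
  ultimately show ?case using C1 by blast
qed

subsection \<open>Sets of vanishing Hausdorff measure\<close>

lemma hausdorff_const_pos: "0 \<le> s \<Longrightarrow> 0 < hausdorff_const s"
  by (simp add: hausdorff_const_def Gamma_real_pos)

text \<open>Start from a nearly optimal cover by sets of small diameter. Each one that meets
  \<open>K\<close> lies in an open ball centred at a common point with \<open>K\<close>, of radius
  slightly above its diameter; compactness leaves finitely many balls.\<close>

lemma hausdorff_null_cover:
  fixes K :: "'a::metric_space set"
  assumes null: "hausdorff_measure (real k) K = 0" and K: "compact K"
    and \<delta>: "0 < \<delta>" and \<epsilon>: "0 < \<epsilon>"
  obtains I :: "nat set" and c r where "finite I" "\<And>i. i \<in> I \<Longrightarrow> c i \<in> K \<and> 0 < r i \<and> r i \<le> \<delta>"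
    "K \<subseteq> (\<Union>i\<in>I. ball (c i) (r i))" "(\<Sum>i\<in>I. r i ^ k) < \<epsilon>"
proof -
  define w where "w = hausdorff_const (real k) / 2 ^ k"
  have w: "0 < w" by (simp add: w_def hausdorff_const_pos)
  have "hausdorff_pre (real k) (\<delta> / 2) K \<le> hausdorff_measure (real k) K"
    unfolding hausdorff_measure_def using \<delta> by (intro SUP_upper) auto
  \<comment> \<open>Half of \<epsilon> is spent on the diameters and the other half on enlarging
    them to radii; the factor \<open>w\<close> converts between \<open>hcontrib\<close> and powers
    of diameters.\<close>
  then have "hausdorff_pre (real k) (\<delta> / 2) K < ennreal (w * (\<epsilon> / 2))"
    using null w \<epsilon> by simp
  then obtain C :: "nat \<Rightarrow> 'a set" where C: "K \<subseteq> (\<Union>i. C i)"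
      "\<And>i. bounded (C i)" "\<And>i. diameter (C i) \<le> \<delta> / 2"
      "(\<Sum>i. hcontrib (real k) (C i)) < ennreal (w * (\<epsilon> / 2))"
    unfolding hausdorff_pre_def INF_less_iff by auto
  define J where "J = {i. C i \<inter> K \<noteq> {}}"
  have d0: "0 \<le> diameter (C i)" for i by (rule diameter_ge_0[OF C(2)])
  \<comment> \<open>For \<open>k = 0\<close> the separate branch of \<open>hcontrib\<close> agrees
    with \<open>x ^ 0 = 1\<close>, even at diameter 0; for larger \<open>k\<close> the two power
    operations agree, also at base 0.\<close>
  have hc: "hcontrib (real k) (C i) = ennreal (w * diameter (C i) ^ k)" if "i \<in> J" for i
  proof -
    have "C i \<noteq> {}" using that by (auto simp: J_def)
    moreover have "(diameter (C i) / 2) powr real k = (diameter (C i) / 2) ^ k" if "k \<noteq> 0"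
      using that d0[of i] by (cases "diameter (C i) = 0") (auto simp: powr_realpow)
    ultimately show ?thesis by (auto simp: hcontrib_def w_def power_divide)
  qed
  \<comment> \<open>By continuity of the power from the right. The strict increase makes the radius
    positive even for a one-point set, and the excesses add up to at most
    \<open>\<epsilon> / 2\<close>.\<close>
  have "\<exists>\<rho>. diameter (C i) < \<rho> \<and> \<rho> \<le> \<delta> \<and> \<rho> ^ k < diameter (C i) ^ k + \<epsilon> / 2 * (1/2) ^ Suc i" for i
  proof -
    let ?d = "diameter (C i)"
    have "((\<lambda>\<rho>. \<rho> ^ k) \<longlongrightarrow> ?d ^ k) (at_right ?d)"
      by (intro tendsto_intros)
    moreover have "?d ^ k < ?d ^ k + \<epsilon> / 2 * (1/2) ^ Suc i" using \<epsilon> by simp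
    ultimately have "\<forall>\<^sub>F \<rho> in at_right ?d. \<rho> ^ k < ?d ^ k + \<epsilon> / 2 * (1/2) ^ Suc i"
      by (rule order_tendstoD)
    moreover have "\<forall>\<^sub>F \<rho> in at_right ?d. \<rho> \<in> {?d<..<\<delta>}"
      using C(3)[of i] \<delta> by (intro eventually_at_right_real) auto
    ultimately have "\<forall>\<^sub>F \<rho> in at_right ?d. \<rho> \<in> {?d<..<\<delta>} \<and> \<rho> ^ k < ?d ^ k + \<epsilon> / 2 * (1/2) ^ Suc i"
      by eventually_elim auto
    then show ?thesis
      using eventually_happens'[OF trivial_limit_at_right_real] by fastforce
  qed
  then obtain r where r: "\<And>i. diameter (C i) < r i" "\<And>i. r i \<le> \<delta>"
      "\<And>i. r i ^ k < diameter (C i) ^ k + \<epsilon> / 2 * (1/2) ^ Suc i"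
    by metis
  have "\<forall>i\<in>J. \<exists>x. x \<in> C i \<inter> K" by (auto simp: J_def)
  then obtain c where c: "\<And>i. i \<in> J \<Longrightarrow> c i \<in> C i \<inter> K" by metis
  have "K \<subseteq> (\<Union>i\<in>J. ball (c i) (r i))"
  proof
    fix x assume x: "x \<in> K"
    then obtain i where i: "x \<in> C i" using C(1) by auto
    then have J: "i \<in> J" using x by (auto simp: J_def)
    have "dist (c i) x \<le> diameter (C i)"
      using c[OF J] i by (intro diameter_bounded_bound[OF C(2)]) auto
    then show "x \<in> (\<Union>i\<in>J. ball (c i) (r i))" using J r(1)[of i] by (auto intro!: bexI[of _ i])
  qed
  then obtain I where I: "I \<subseteq> J" "finite I" "K \<subseteq> (\<Union>i\<in>I. ball (c i) (r i))"
    using compactE_image[OF K, of J "\<lambda>i. ball (c i) (r i)"] by auto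
  have "(\<Sum>i\<in>I. r i ^ k) < \<epsilon>"
  proof -
    have "ennreal (w * (\<Sum>i\<in>I. diameter (C i) ^ k)) = ennreal (\<Sum>i\<in>I. w * diameter (C i) ^ k)"
      by (simp only: sum_distrib_left)
    also have "\<dots> = (\<Sum>i\<in>I. ennreal (w * diameter (C i) ^ k))"
      using w d0 by (intro sum_ennreal[symmetric]) simp
    also have "\<dots> = (\<Sum>i\<in>I. hcontrib (real k) (C i))"
      using I(1) hc by (intro sum.cong) auto
    also have "\<dots> \<le> (\<Sum>i. hcontrib (real k) (C i))"
      by (rule sum_le_suminf) (use I in auto)
    also note C(4)
    finally have "(\<Sum>i\<in>I. diameter (C i) ^ k) < \<epsilon> / 2"
      using w d0 by (simp add: ennreal_less_iff sum_nonneg)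
    moreover have "(\<Sum>i\<in>I. (1/2::real) ^ Suc i) \<le> 1"
      using sum_le_suminf[of "\<lambda>i. (1/2::real) ^ Suc i" I] power_half_series I(2)
      by (auto simp: sums_iff)
    then have "(\<Sum>i\<in>I. \<epsilon> / 2 * (1/2) ^ Suc i) \<le> \<epsilon> / 2"
      unfolding sum_distrib_left[symmetric] using \<epsilon> by (simp add: mult_left_le)
    moreover have "(\<Sum>i\<in>I. r i ^ k) \<le> (\<Sum>i\<in>I. diameter (C i) ^ k + \<epsilon> / 2 * (1/2) ^ Suc i)"
      by (intro sum_mono less_imp_le r)
    ultimately show ?thesis by (simp only: sum.distrib)
  qed
  moreover have "c i \<in> K \<and> 0 < r i \<and> r i \<le> \<delta>" if "i \<in> I" for i
    using that I c[of i] r[of i] d0[of i] by auto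
  ultimately show thesis using that I by blast
qed

text \<open>A ball inside \<open>K\<close> would be covered by balls of radii at most 1, whose
  volumes \<open>V * r ^ n\<close> are at most \<open>V * r ^ (n - 1)\<close>; the sum of these can
  be made smaller than the volume of that ball.\<close>

lemma hausdorff_null_interior_empty:
  fixes K :: "'a::euclidean_space set"
  assumes null: "hausdorff_measure (real DIM('a) - 1) K = 0" and K: "compact K"
  shows "interior K = {}"
proof (rule ccontr)
  assume "interior K \<noteq> {}"
  then obtain x \<rho> where \<rho>: "0 < \<rho>" "ball x \<rho> \<subseteq> K"
    by (meson all_not_in_conv mem_interior)
  define V where "V = unit_ball_vol (real DIM('a))"
  have V: "0 < V" by (simp add: V_def unit_ball_vol_pos)
  have dim: "real DIM('a) - 1 = real (DIM('a) - 1)" by (simp add: of_nat_diff Suc_leI)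
  have pos: "0 < measure lborel (ball x \<rho>) / V" using \<rho>(1) V by (simp add: content_ball_pos)
  obtain I :: "nat set" and c r where I: "finite I" "\<And>i. i \<in> I \<Longrightarrow> c i \<in> K \<and> 0 < r i \<and> r i \<le> 1"
    "K \<subseteq> (\<Union>i\<in>I. ball (c i) (r i))" "(\<Sum>i\<in>I. r i ^ (DIM('a) - 1)) < measure lborel (ball x \<rho>) / V"
    by (rule hausdorff_null_cover[OF null[unfolded dim] K zero_less_one pos]) (rule that)
  have "measure lborel (ball x \<rho>) \<le> measure lborel (\<Union>i\<in>I. ball (c i) (r i))"
    using \<rho>(2) I(1,3) by (intro measure_mono_fmeasurable fmeasurable.finite_UN fmeasurableI
        emeasure_lborel_ball_finite) auto
  also have "\<dots> \<le> (\<Sum>i\<in>I. measure lborel (ball (c i) (r i)))"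
    using I(1) by (intro measure_UNION_le) auto
  also have "\<dots> \<le> (\<Sum>i\<in>I. V * r i ^ (DIM('a) - 1))"
  proof (rule sum_mono)
    fix i assume "i \<in> I"
    then have "0 < r i" "r i \<le> 1" using I(2) by auto
    then show "measure lborel (ball (c i) (r i)) \<le> V * r i ^ (DIM('a) - 1)"
      using V by (simp add: content_ball V_def power_decreasing)
  qed
  also have "\<dots> < measure lborel (ball x \<rho>)"
    using I(4) V by (simp add: sum_distrib_left[symmetric] field_simps)
  finally show False by simp
qed

subsection \<open>The comparison principle\<close>

text \<open>The integral argument for abstract fields: \<open>g\<close>, \<open>w\<close>,
  \<open>X\<close> stand for \<open>u - v\<close>, its gradient and the difference of the normalized
  fields. If \<open>w \<bullet> X\<close> were positive at \<open>x0\<close>, it would contribute a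
  fixed positive amount on a ball, more than a sufficiently fine cutoff around \<open>K\<close> can
  cost.\<close>

lemma gradient_inner_zero_of_subsolution:
  fixes X w :: "'a::euclidean_space \<Rightarrow> 'a"
  assumes \<Omega>: "open \<Omega>" "bounded \<Omega>"
    and K: "compact K" "hausdorff_measure (real DIM('a) - 1) K = 0"
    and g: "has_C1_deriv (\<Omega> - K) g (\<lambda>x h. w x \<bullet> h)" "continuous_on (\<Omega> - K) w"
      "continuous_on (closure \<Omega> - K) g" "\<And>x. x \<in> frontier \<Omega> - K \<Longrightarrow> g x \<le> 0"
    and X: "has_C1_deriv (\<Omega> - K) X X'" "\<And>x. x \<in> \<Omega> - K \<Longrightarrow> norm (X x) \<le> M"
      "\<And>x. x \<in> \<Omega> - K \<Longrightarrow> 0 \<le> (\<Sum>b\<in>Basis. X' x b \<bullet> b)"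
    and wX: "\<And>x. x \<in> \<Omega> - K \<Longrightarrow> 0 \<le> w x \<bullet> X x"
    and x0: "x0 \<in> \<Omega> - K" "0 < g x0"
  shows "w x0 \<bullet> X x0 = 0"
proof (rule ccontr)
  assume nz: "w x0 \<bullet> X x0 \<noteq> 0"
  let ?D = "\<Omega> - K"
  have D: "open ?D" using \<Omega>(1) K(1) by (simp add: compact_imp_closed open_Diff)
  have M: "0 \<le> M" using X(2)[OF x0(1)] norm_ge_zero order_trans by blast
  \<comment> \<open>Positive, so that the level \<epsilon> is not reached on the boundary; below
    \<open>g x0\<close>, so that \<open>bump'\<close> is positive at \<open>x0\<close>.\<close>
  define \<epsilon> where "\<epsilon> = g x0 / 2"
  have \<epsilon>: "0 < \<epsilon>" "\<epsilon> < g x0" using x0(2) by (auto simp: \<epsilon>_def)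
  define f where "f x = bump' (g x - \<epsilon>) * (w x \<bullet> X x)" for x
  have f_nonneg: "0 \<le> f x" if "x \<in> ?D" for x
    using wX[OF that] by (simp add: f_def bump'_nonneg)
  have cf: "continuous_on ?D f"
    unfolding f_def
    by (intro continuous_intros continuous_on_compose2[OF continuous_on_bump'[of UNIV]] g(2)
        has_C1_deriv_continuous_on[OF X(1)] has_C1_deriv_continuous_on[OF g(1)]) auto
  define m where "m = f x0 / 2"
  have m: "0 < m" "m < f x0"
    using nz wX[OF x0(1)] bump'_pos[of "g x0 - \<epsilon>"] \<epsilon>(2) by (auto simp: m_def f_def)
  have "open (?D \<inter> f -` {m<..})"
    by (rule continuous_open_preimage[OF cf D]) simp
  then obtain \<sigma> where \<sigma>: "0 < \<sigma>" "ball x0 \<sigma> \<subseteq> ?D \<inter> f -` {m<..}"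
    using x0(1) m(2) open_contains_ball by (metis IntI greaterThan_iff vimageI)
  \<comment> \<open>The covering balls have centres in \<open>K\<close>, hence outside
    \<open>ball x0 \<sigma>\<close>, and doubled radii at most \<rho>. They therefore miss the
    half-size ball \<open>B\<close>, where the cutoff equals 1.\<close>
  define \<rho> where "\<rho> = \<sigma> / 2"
  define B where "B = ball x0 \<rho>"
  have \<rho>: "0 < \<rho>" "\<sigma> = 2 * \<rho>" using \<sigma>(1) by (auto simp: \<rho>_def)
  have B: "B \<subseteq> ?D" "\<And>x. x \<in> B \<Longrightarrow> m \<le> f x"
    using \<sigma> subset_ball[of \<rho> \<sigma> x0] \<rho> by (auto simp: B_def dest!: subsetD simp del: mem_ball)
  define V where "V = unit_ball_vol (real DIM('a))"
  have V: "0 < V" by (simp add: V_def unit_ball_vol_pos)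
  have dim: "real DIM('a) - 1 = real (DIM('a) - 1)" by (simp add: of_nat_diff Suc_leI)
  \<comment> \<open>Collects the derivative bound \<open>6 / r\<close>, the volume of a ball of
    radius \<open>2 * r\<close>, and a bound for \<open>X\<close>; \<open>M + 1\<close> replaces
    \<open>M\<close> to keep \<open>C\<close> positive.\<close>
  define C where "C = 6 * (M + 1) * (2 ^ DIM('a) * V)"
  have C: "0 < C" using M V by (simp add: C_def)
  have pos: "0 < m * measure lborel B / C"
    using \<rho>(1) C m(1) by (simp add: content_ball_pos B_def)
  have \<rho>2: "0 < \<rho> / 2" using \<rho> by simp
  obtain I :: "nat set" and c r where I: "finite I" "\<And>i. i \<in> I \<Longrightarrow> c i \<in> K \<and> 0 < r i \<and> r i \<le> \<rho> / 2"
    "K \<subseteq> (\<Union>i\<in>I. ball (c i) (r i))" "(\<Sum>i\<in>I. r i ^ (DIM('a) - 1)) < m * measure lborel B / C"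
    by (rule hausdorff_null_cover[OF K(2)[unfolded dim] K(1) \<rho>2 pos]) (rule that)
  define S where "S x = (\<Sum>i\<in>I. 6 / r i * indicator (cball (c i) (2 * r i)) x)" for x
  have "\<exists>\<theta> \<theta>'. has_C1_deriv UNIV \<theta> \<theta>' \<and> (\<forall>x. 0 \<le> \<theta> x \<and> \<theta> x \<le> 1) \<and>
    (\<forall>x \<in> (\<Union>i\<in>I. ball (c i) (r i)). \<theta> x = 0) \<and>
    (\<forall>x. x \<notin> (\<Union>i\<in>I. cball (c i) (2 * r i)) \<longrightarrow> \<theta> x = 1) \<and>
    (\<forall>x h. \<bar>\<theta>' x h\<bar> \<le> S x * norm h)"
    unfolding S_def by (rule finite_balls_cutoff) (use I in auto)
  then obtain \<theta> \<theta>' where \<theta>: "has_C1_deriv UNIV \<theta> \<theta>'" "\<And>x. 0 \<le> \<theta> x \<and> \<theta> x \<le> 1"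
    "\<And>x. x \<in> (\<Union>i\<in>I. ball (c i) (r i)) \<Longrightarrow> \<theta> x = 0"
    "\<And>x. x \<notin> (\<Union>i\<in>I. cball (c i) (2 * r i)) \<Longrightarrow> \<theta> x = 1"
    "\<And>x h. \<bar>\<theta>' x h\<bar> \<le> S x * norm h"
    by (elim exE conjE) (rule that, assumption, blast+)
  have S0: "0 \<le> S x" for x
    unfolding S_def using I(2) by (intro sum_nonneg) (auto simp: less_imp_le)
  have \<theta>B: "\<theta> x = 1" if x: "x \<in> B" for x
  proof (rule \<theta>(4), rule notI)
    assume "x \<in> (\<Union>i\<in>I. cball (c i) (2 * r i))"
    then obtain i where i: "i \<in> I" "dist (c i) x \<le> 2 * r i" by auto
    then have "dist (c i) x \<le> \<rho>" using I(2)[OF i(1)] by simp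
    then have "c i \<in> ball x0 \<sigma>"
      using x \<rho> dist_triangle_less_add[of x0 x \<rho> "c i" \<rho>] dist_triangle[of x0 "c i" x]
      by (simp add: B_def dist_commute)
    then show False using \<sigma>(2) I(2)[OF i(1)] by auto
  qed
  define P where "P x = \<theta> x * bump (g x - \<epsilon>)" for x
  define P' where "P' x h = \<theta> x * (bump' (g x - \<epsilon>) * (w x \<bullet> h)) + \<theta>' x h * bump (g x - \<epsilon>)" for x h
  have "has_C1_deriv ?D (\<lambda>x. bump (g x - \<epsilon>)) (\<lambda>x h. bump' (g x - \<epsilon>) * (w x \<bullet> h))"
  proof (rule has_C1_deriv_compose_real[OF g(1), of UNIV])
    show "((\<lambda>t. bump (t - \<epsilon>)) has_real_derivative bump' (t - \<epsilon>)) (at t)" for t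
      using DERIV_chain2[OF bump_has_derivative DERIV_diff[OF DERIV_ident DERIV_const], of \<epsilon> t UNIV]
      by simp
    show "continuous_on UNIV (\<lambda>t. bump' (t - \<epsilon>))"
      by (intro continuous_on_compose2[OF continuous_on_bump'[of UNIV]] continuous_intros) auto
  qed auto
  then have P: "has_C1_deriv ?D P P'"
    unfolding P_def[abs_def] P'_def[abs_def]
    by (rule has_C1_deriv_mult[OF has_C1_deriv_subset[OF \<theta>(1) subset_UNIV]])
  have W: "has_C1_deriv ?D (\<lambda>x. P x *\<^sub>R X x) (\<lambda>x h. P x *\<^sub>R X' x h + P' x h *\<^sub>R X x)"
    by (rule has_C1_deriv_scaleR[OF P X(1)])
  \<comment> \<open>Contains the set where the test field is nonzero. Removing the balls keeps it
    away from \<open>K\<close>, and \<open>g \<ge> \<epsilon>\<close> keeps it off the frontier,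
    where \<open>g \<le> 0\<close>.\<close>
  define A where "A = (closure \<Omega> - (\<Union>i\<in>I. ball (c i) (r i))) \<inter> g -` {\<epsilon>..}"
  have "closed A"
    unfolding A_def
  proof (rule continuous_closed_preimage)
    show "continuous_on (closure \<Omega> - (\<Union>i\<in>I. ball (c i) (r i))) g"
      by (rule continuous_on_subset[OF g(3)]) (use I(3) in auto)
  qed auto
  then have A: "compact A"
    using \<Omega>(2) by (auto simp: compact_eq_bounded_closed A_def intro: bounded_subset[of "closure \<Omega>"])
  have AD: "A \<subseteq> ?D"
  proof
    fix x assume x: "x \<in> A"
    then have "x \<notin> K" using I(3) by (auto simp: A_def)
    moreover have "x \<notin> frontier \<Omega>" using g(4)[of x] x \<epsilon>(1) \<open>x \<notin> K\<close> by (auto simp: A_def)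
    ultimately show "x \<in> ?D"
      using x \<Omega>(1) by (auto simp: A_def frontier_def interior_open)
  qed
  have supp: "P x *\<^sub>R X x = 0" if "x \<in> ?D - A" for x
  proof -
    have "x \<in> closure \<Omega>" using that closure_subset by auto
    then have "x \<in> (\<Union>i\<in>I. ball (c i) (r i)) \<or> g x < \<epsilon>" using that by (auto simp: A_def)
    then have "P x = 0" using \<theta>(3)[of x] bump_nonpos[of "g x - \<epsilon>"] by (auto simp: P_def)
    then show ?thesis by simp
  qed
  let ?div = "\<lambda>x. if x \<in> ?D then \<Sum>b\<in>Basis. (P x *\<^sub>R X' x b + P' x b *\<^sub>R X x) \<bullet> b else 0"
  have int: "has_bochner_integral lborel ?div 0"
    by (rule integral_divergence_zero[OF W D A AD supp])
  \<comment> \<open>The divergence has three terms: \<open>P\<close> times the divergence of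
    \<open>X\<close>, which is nonnegative; \<open>\<theta> * f\<close>, at least \<open>m\<close>
    on \<open>B\<close> and nonnegative elsewhere; and the cutoff error, at most
    \<open>(M + 1) * S\<close> in absolute value.\<close>
  have lower: "m * indicator B x - (M + 1) * S x \<le> ?div x" for x
  proof (cases "x \<in> ?D")
    case False
    then have "x \<notin> B" "0 \<le> (M + 1) * S x" using B(1) M S0[of x] by auto
    then show ?thesis unfolding if_not_P[OF False] by simp
  next
    case True
    have lin: "linear (P' x)"
      using has_C1_deriv_derivative[OF P True] by (rule has_derivative_linear)
    have "(\<Sum>b\<in>Basis. (P x *\<^sub>R X' x b + P' x b *\<^sub>R X x) \<bullet> b) =
        P x * (\<Sum>b\<in>Basis. X' x b \<bullet> b) + (\<Sum>b\<in>Basis. (X x \<bullet> b) * P' x b)"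
      by (simp add: inner_add_left sum.distrib sum_distrib_left mult.commute)
    \<comment> \<open>Linearity turns the sum into the derivative of \<open>P\<close> along
      \<open>X\<close>, where \<open>w \<bullet> X\<close> appears.\<close>
    also have "(\<Sum>b\<in>Basis. (X x \<bullet> b) * P' x b) = P' x (\<Sum>b\<in>Basis. (X x \<bullet> b) *\<^sub>R b)"
      by (simp add: lin linear_sum linear_scale)
    also have "(\<Sum>b\<in>Basis. (X x \<bullet> b) *\<^sub>R b) = X x" by (rule euclidean_representation)
    also have "P' x (X x) = \<theta> x * f x + \<theta>' x (X x) * bump (g x - \<epsilon>)"
      by (simp add: P'_def f_def)
    finally have eq: "?div x = P x * (\<Sum>b\<in>Basis. X' x b \<bullet> b) +
        (\<theta> x * f x + \<theta>' x (X x) * bump (g x - \<epsilon>))"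
      using True by simp
    have 1: "0 \<le> P x * (\<Sum>b\<in>Basis. X' x b \<bullet> b)"
      using X(3)[OF True] \<theta>(2)[of x] by (simp add: P_def bump_bounds)
    have 2: "m * indicator B x \<le> \<theta> x * f x"
      using B(2)[of x] \<theta>B[of x] \<theta>(2)[of x] f_nonneg[OF True] by (cases "x \<in> B") auto
    have "\<bar>\<theta>' x (X x) * bump (g x - \<epsilon>)\<bar> \<le> \<bar>\<theta>' x (X x)\<bar> * 1"
      unfolding abs_mult using bump_bounds by (intro mult_left_mono) auto
    also have "\<dots> \<le> S x * norm (X x)" using \<theta>(5) by simp
    also have "\<dots> \<le> S x * (M + 1)" using S0 X(2)[OF True] by (intro mult_left_mono) auto
    finally have 3: "- ((M + 1) * S x) \<le> \<theta>' x (X x) * bump (g x - \<epsilon>)"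
      by (simp add: mult.commute)
    show ?thesis unfolding eq using 1 2 3 by linarith
  qed
  have fin: "emeasure lborel (cball (a::'a) s) < \<infinity>" "emeasure lborel (ball a s) < \<infinity>" for a s
    by (rule emeasure_lborel_cball_finite emeasure_lborel_ball_finite)+
  have "has_bochner_integral lborel S (\<Sum>i\<in>I. 6 / r i * measure lborel (cball (c i) (2 * r i)))"
    unfolding S_def
    by (intro has_bochner_integral_sum has_bochner_integral_mult_right has_bochner_integral_real_indicator fin)
       auto
  then have int_lower: "has_bochner_integral lborel (\<lambda>x. m * indicator B x - (M + 1) * S x)
      (m * measure lborel B - (M + 1) * (\<Sum>i\<in>I. 6 / r i * measure lborel (cball (c i) (2 * r i))))"
    unfolding B_def
    by (intro has_bochner_integral_diff has_bochner_integral_mult_right has_bochner_integral_real_indicator fin)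
       auto
  have "integral\<^sup>L lborel (\<lambda>x. m * indicator B x - (M + 1) * S x) \<le> integral\<^sup>L lborel ?div"
    by (rule integral_mono[OF integrable.intros[OF int_lower] integrable.intros[OF int] lower])
  then have "m * measure lborel B - (M + 1) * (\<Sum>i\<in>I. 6 / r i * measure lborel (cball (c i) (2 * r i))) \<le> 0"
    by (simp only: has_bochner_integral_integral_eq[OF int_lower] has_bochner_integral_integral_eq[OF int])
  \<comment> \<open>One power of the radius in the volume cancels against \<open>6 / r i\<close>,
    leaving the exponent \<open>n - 1\<close> of the Hausdorff sum.\<close>
  also have "(\<Sum>i\<in>I. 6 / r i * measure lborel (cball (c i) (2 * r i))) =
      (\<Sum>i\<in>I. 6 * (2 ^ DIM('a) * V) * r i ^ (DIM('a) - 1))"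
  proof (rule sum.cong[OF refl])
    fix i assume "i \<in> I"
    then have "0 < r i" using I(2) by auto
    then show "6 / r i * measure lborel (cball (c i) (2 * r i)) = 6 * (2 ^ DIM('a) * V) * r i ^ (DIM('a) - 1)"
      by (simp add: content_cball V_def power_mult_distrib power_eq_if[of "r i" "DIM('a)"])
  qed
  also have "(M + 1) * \<dots> = C * (\<Sum>i\<in>I. r i ^ (DIM('a) - 1))"
    by (simp only: C_def sum_distrib_left mult_ac)
  finally show False using I(4) C by (simp add: field_simps)
qed

text \<open>For unit vectors \<open>p\<close> and \<open>q\<close> in the directions of
  \<open>a\<close> and \<open>b\<close>, the left side is
  \<open>(norm a + norm b) * (1 - p \<bullet> q)\<close>, and the squared norm of
  \<open>p - q\<close> is \<open>2 * (1 - p \<bullet> q)\<close>. This gives both the sign and the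
  equality case.\<close>

lemma normalized_diff_inner:
  fixes a b :: "'a::real_inner"
  assumes "a \<noteq> 0" "b \<noteq> 0"
  shows "(a - b) \<bullet> ((1 / norm a) *\<^sub>R a - (1 / norm b) *\<^sub>R b) =
    (norm a + norm b) / 2 * (norm ((1 / norm a) *\<^sub>R a - (1 / norm b) *\<^sub>R b))\<^sup>2"
proof -
  define p q where "p = (1 / norm a) *\<^sub>R a" and "q = (1 / norm b) *\<^sub>R b"
  have a: "a = norm a *\<^sub>R p" and b: "b = norm b *\<^sub>R q" using assms by (auto simp: p_def q_def)
  have "norm p = 1" "norm q = 1" using assms by (auto simp: p_def q_def)
  then have 1: "p \<bullet> p = 1" "q \<bullet> q = 1" by (auto simp: dot_square_norm)
  have "(norm a *\<^sub>R p - norm b *\<^sub>R q) \<bullet> (p - q) = (norm a + norm b) / 2 * (norm (p - q))\<^sup>2"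
    by (simp add: power2_norm_eq_inner inner_diff_left inner_diff_right 1 inner_commute[of q p] field_simps)
  then show ?thesis unfolding p_def[symmetric] q_def[symmetric] using a b by simp
qed

section \<open>Regularity of the normalized fields\<close>

lemma C1_on_subset: "C1_on D f \<Longrightarrow> E \<subseteq> D \<Longrightarrow> C1_on E f"
  unfolding C1_on_def by (meson continuous_on_subset subsetD)

lemma C2_on_has_C1_deriv:
  assumes "C2_on D u"
  shows "has_C1_deriv D u (\<lambda>x h. grad u x \<bullet> h)"
proof (rule has_C1_derivI)
  have C1: "C1_on D u" "C1_on D (grad u)" using assms by (auto simp: C2_on_def)
  show "(u has_derivative (\<lambda>h. grad u x \<bullet> h)) (at x)" if "x \<in> D" for x
  proof -
    have "frechet_derivative u (at x) = (\<lambda>h. grad u x \<bullet> h)"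
      using C1(1) that by (intro ext frechet_derivative_eq_grad) (auto simp: C1_on_def)
    then show ?thesis
      using has_C1_deriv_derivative[OF C1_on_has_C1_deriv[OF C1(1)] that] by simp
  qed
  show "continuous_on D (\<lambda>x. grad u x \<bullet> h)" for h
    by (intro continuous_intros has_C1_deriv_continuous_on[OF C1_on_has_C1_deriv[OF C1(2)]])
qed

lemma nfield_has_C1_deriv:
  assumes "C2_on D u" "C1_on D F" and nz: "\<And>x. x \<in> D \<Longrightarrow> grad u x + F x \<noteq> 0"
  obtains N' where "has_C1_deriv D (nfield u F) N'"
proof -
  let ?G = "\<lambda>x. grad u x + F x"
  have "C1_on D (grad u)" using assms(1) by (simp add: C2_on_def)
  note G = has_C1_deriv_add[OF C1_on_has_C1_deriv[OF this] C1_on_has_C1_deriv[OF assms(2)]]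
  have k: "((\<lambda>t. 1 / sqrt t) has_real_derivative - inverse (sqrt t) / 2 / (sqrt t)\<^sup>2) (at t)"
    if "t \<in> {0<..}" for t
    using that by (auto intro!: derivative_eq_intros simp: power2_eq_square divide_simps)
  \<comment> \<open>Written through the inner product, the normalization falls under the inner
    product, chain and product rules, with \<open>1 / sqrt t\<close> on the positive reals.\<close>
  have eq: "nfield u F = (\<lambda>x. (1 / sqrt (?G x \<bullet> ?G x)) *\<^sub>R ?G x)"
    by (simp add: fun_eq_iff nfield_def norm_eq_sqrt_inner)
  have ck: "continuous_on {0<..} (\<lambda>t::real. - inverse (sqrt t) / 2 / (sqrt t)\<^sup>2)"
    by (intro continuous_intros) auto
  have img: "(\<lambda>x. ?G x \<bullet> ?G x) ` D \<subseteq> {0<..}"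
    using nz by auto
  show thesis
    by (rule that, unfold eq)
       (rule has_C1_deriv_scaleR[OF has_C1_deriv_compose_real[OF has_C1_deriv_inner[OF G G] k ck img] G])
qed

section \<open>Equality of the normalized fields off the singular set\<close>

theorem theorem5p2:
  fixes \<Omega> S1 S2 :: "'a::euclidean_space set"
    and F :: "'a \<Rightarrow> 'a"
    and u v :: "'a \<Rightarrow> real"
  assumes "open \<Omega>" "connected \<Omega>" "bounded \<Omega>"
    and "S1 \<subseteq> \<Omega>" "S2 \<subseteq> \<Omega>"
    and "C1_on \<Omega> F" "continuous_on (closure \<Omega>) F"
    and "continuous_on (closure \<Omega> - S1) u"
    and "continuous_on (closure \<Omega> - S2) v"
    and "C2_on (\<Omega> - (S1 \<union> S2 \<union> singset \<Omega> S1 u F \<union> singset \<Omega> S2 v F)) u"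
    and "C2_on (\<Omega> - (S1 \<union> S2 \<union> singset \<Omega> S1 u F \<union> singset \<Omega> S2 v F)) v"
    and "hausdorff_measure (real DIM('a) - 1)
           (closure (S1 \<union> S2 \<union> singset \<Omega> S1 u F \<union> singset \<Omega> S2 v F)) = 0"
    and "\<forall>x \<in> \<Omega> - (S1 \<union> S2 \<union> singset \<Omega> S1 u F \<union> singset \<Omega> S2 v F).
           divergence (nfield u F) x \<ge> divergence (nfield v F) x"
    and "\<forall>x \<in> frontier \<Omega> - (S1 \<union> S2 \<union> singset \<Omega> S1 u F \<union> singset \<Omega> S2 v F).
           u x \<le> v x"
  shows "\<forall>x \<in> {p \<in> \<Omega>. u p - v p > 0} - (S1 \<union> S2 \<union> singset \<Omega> S1 u F \<union> singset \<Omega> S2 v F).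
           nfield u F x = nfield v F x"
proof -
  define S where "S = S1 \<union> S2 \<union> singset \<Omega> S1 u F \<union> singset \<Omega> S2 v F"
  note assms = assms[folded S_def]
  define K where "K = closure S"
  have "S \<subseteq> \<Omega>" using assms(4,5) by (auto simp: S_def singset_def)
  then have K: "compact K"
    using assms(3) bounded_subset by (auto simp: K_def)
  have sub: "\<Omega> - K \<subseteq> \<Omega> - S" using closure_subset by (auto simp: K_def)
  have null: "hausdorff_measure (real DIM('a) - 1) K = 0" using assms(12) by (simp add: K_def)
  have F: "C1_on (\<Omega> - S) F" by (rule C1_on_subset[OF assms(6)]) auto
  \<comment> \<open>\<open>singset\<close> only records zeros at points of differentiability; here
    \<open>C2_on\<close> supplies differentiability, so a zero would put \<open>x\<close> into
    \<open>S\<close>.\<close>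
  have nz: "grad u x + F x \<noteq> 0" "grad v x + F x \<noteq> 0" if x: "x \<in> \<Omega> - S" for x
  proof -
    have "u differentiable (at x)" "v differentiable (at x)"
      using assms(10,11) x unfolding C2_on_def C1_on_def by blast+
    then show "grad u x + F x \<noteq> 0" "grad v x + F x \<noteq> 0"
      using x unfolding S_def singset_def by blast+
  qed
  obtain N1' where N1: "has_C1_deriv (\<Omega> - S) (nfield u F) N1'"
    by (rule nfield_has_C1_deriv[OF assms(10) F nz(1)]) (assumption, rule that)
  obtain N2' where N2: "has_C1_deriv (\<Omega> - S) (nfield v F) N2'"
    by (rule nfield_has_C1_deriv[OF assms(11) F nz(2)]) (assumption, rule that)
  define X where "X x = nfield u F x - nfield v F x" for x
  define w where "w x = grad u x - grad v x" for x
  have X: "has_C1_deriv (\<Omega> - S) X (\<lambda>x h. N1' x h - N2' x h)"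
    unfolding X_def by (rule has_C1_deriv_diff[OF N1 N2])
  have div: "0 \<le> (\<Sum>b\<in>Basis. (N1' x b - N2' x b) \<bullet> b)" if "x \<in> \<Omega> - S" for x
    using bspec[OF assms(13) that] divergence_eq[OF has_C1_deriv_derivative[OF N1 that]]
      divergence_eq[OF has_C1_deriv_derivative[OF N2 that]]
    by (simp add: inner_diff_left sum_subtractf)
  have g: "has_C1_deriv (\<Omega> - S) (\<lambda>x. u x - v x) (\<lambda>x h. w x \<bullet> h)"
    using has_C1_deriv_diff[OF C2_on_has_C1_deriv[OF assms(10)] C2_on_has_C1_deriv[OF assms(11)]]
    by (simp add: w_def inner_diff_left)
  have cw: "continuous_on (\<Omega> - S) w"
    unfolding w_def using assms(10,11) has_C1_deriv_continuous_on[OF C1_on_has_C1_deriv]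
    by (intro continuous_intros) (auto simp: C2_on_def)
  have cg: "continuous_on (closure \<Omega> - S) (\<lambda>x. u x - v x)"
    by (intro continuous_intros continuous_on_subset[OF assms(8)] continuous_on_subset[OF assms(9)])
       (auto simp: S_def)
  \<comment> \<open>\<open>F\<close> cancels in the difference, so \<open>w\<close> is also the
    difference of the two fields before normalization.\<close>
  have wX: "w x \<bullet> X x = (norm (grad u x + F x) + norm (grad v x + F x)) / 2 * (norm (X x))\<^sup>2"
    if "x \<in> \<Omega> - S" for x
    using normalized_diff_inner[OF nz[OF that]] by (simp add: w_def X_def nfield_def)
  have nX: "norm (X x) \<le> 2" if "x \<in> \<Omega> - S" for x
  proof -
    have "norm (nfield u F x) = 1" "norm (nfield v F x) = 1"
      using nz[OF that] by (auto simp: nfield_def)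
    then show ?thesis
      using norm_triangle_ineq4[of "nfield u F x" "nfield v F x"] by (simp add: X_def)
  qed
  \<comment> \<open>Removing the closure \<open>K\<close> instead of \<open>S\<close> makes the
    domain open, as the divergence theorem requires.\<close>
  have off_K: "X x = 0" if x: "x \<in> \<Omega> - K" "0 < u x - v x" for x
  proof -
    have "w x \<bullet> X x = 0"
    proof (rule gradient_inner_zero_of_subsolution[OF assms(1,3) K null
          has_C1_deriv_subset[OF g sub] continuous_on_subset[OF cw sub] _ _
          has_C1_deriv_subset[OF X sub] _ _ _ x])
      show "continuous_on (closure \<Omega> - K) (\<lambda>x. u x - v x)"
        by (rule continuous_on_subset[OF cg]) (use closure_subset in \<open>auto simp: K_def\<close>)
      show "u y - v y \<le> 0" if "y \<in> frontier \<Omega> - K" for y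
      proof -
        have "y \<in> frontier \<Omega> - S" using that closure_subset by (auto simp: K_def)
        then show ?thesis using assms(14) by auto
      qed
      show "0 \<le> w y \<bullet> X y" if "y \<in> \<Omega> - K" for y
        unfolding wX[OF subsetD[OF sub that]] by simp
    qed (use sub nX div in auto)
    then show ?thesis
      using wX[of x] nz[of x] sub x(1) by (auto simp: add_nonneg_eq_0_iff)
  qed
  \<comment> \<open>Points of \<open>K - S\<close> remain. They are limits of points off
    \<open>K\<close> at which \<open>u - v\<close> is still positive, and \<open>X\<close> is
    continuous on \<open>\<Omega> - S\<close>.\<close>
  have "X x = 0" if x: "x \<in> \<Omega> - S" "0 < u x - v x" for x
  proof -
    let ?T = "(\<Omega> - S) \<inter> (\<lambda>x. u x - v x) -` {0<..}"
    have "continuous_on (\<Omega> - S) (\<lambda>x. u x - v x)" by (rule has_C1_deriv_continuous_on[OF g])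
    \<comment> \<open>Positivity is only relatively open in \<open>\<Omega> - S\<close>;
      \<open>U\<close> is an open set of the whole space that induces it, so it can be intersected
      with the dense set \<open>- K\<close>.\<close>
    then obtain U where U: "open U" "U \<inter> (\<Omega> - S) = ?T"
      unfolding continuous_on_open_invariant by (metis open_greaterThan Int_commute)
    have "x \<in> closure (- K)"
      using hausdorff_null_interior_empty[OF null K] by (simp add: closure_complement)
    moreover have "open (U \<inter> \<Omega>)" "x \<in> U \<inter> \<Omega>" using U x assms(1) by auto
    ultimately have "x \<in> closure (U \<inter> \<Omega> \<inter> - K)"
      using open_Int_closure_subset by blast
    then obtain y where y: "\<And>n. y n \<in> U \<inter> \<Omega> \<inter> - K" "y \<longlonglongrightarrow> x"
      unfolding closure_sequential by auto
    have yS: "y n \<in> \<Omega> - S" for n using y(1)[of n] sub by auto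
    have "X (y n) = 0" for n
    proof (rule off_K)
      have "y n \<in> ?T" using y(1)[of n] yS[of n] U(2) by blast
      then show "0 < u (y n) - v (y n)" by simp
    qed (use y(1)[of n] in auto)
    moreover have "(\<lambda>n. X (y n)) \<longlonglongrightarrow> X x"
      using has_C1_deriv_continuous_on[OF X] x(1) y(2) yS
      unfolding continuous_on_sequentially comp_def by blast
    ultimately show ?thesis by (simp add: LIMSEQ_const_iff)
  qed
  then show ?thesis by (auto simp: X_def S_def)
qed

end
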